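(* Let $0<a<1$ and $0\le b<1$. (i) Suppose that the rotation number $\rho=\rho(f_\pm)$ of $f_\pm$ is rational, say $\rho=p/q$ in lowest terms. Then $f_\pm$ has a periodic orbit $C$ of length exactly $q$. Furthermore, $C=\{\phi_\rho(k/q):k=0,\dots,q-1\}$. In particular, $$\min C=\phi_\rho(0)=\psi(\rho),\qquad \max C=\phi_\rho((q-1)/q)=\phi_\rho(1-)=1+\psi(\rho+).$$ (ii) Conversely, if $f_\pm$ has a periodic orbit, then the rotation number is rational. Moreover, if the periodic orbit is minimal and has length $q$, then $\rho(f_\pm)$ has denominator $q$ in lowest terms.
   Context: For real $x$ let $\{x\}:=x-\lfloor x\rfloor\in[0,1)$ and $\{x\}_+:=1-\{-x\}\in(0,1]$. For constants $0<a<1$, $0\le b<1$ define $f_-,f_+:[0,1]\to[0,1]$ by $f_-(x)=\{ax+b\}$, $f_+(x)=\{ax+b\}_+$, and let $f_\pm$ be the multi-valued map $x\mapsto\{f_-(x),f_+(x)\}$. An orbit of $x\in[0,1]$ under $f_\pm$ is any sequence $(x_n)_{n\ge0}$ with $x_0=x$ and $x_{n+1}\in f_\pm(x_n)$ for all $n\ge0$. A periodic orbit is an orbit with $x_{n+q}=x_n$ for some $q\ge1$ (the period, or length) and all $n\ge0$; it is then written $\{x_0,\dots,x_{q-1}\}$. It is minimal if $x_0,\dots,x_{q-1}$ are distinct. Rotation number: let $F_-(x):=ax+b+(1-a)\lfloor x\rfloor$ and $F_+(x):=ax+b-(1-a)\lfloor 1-x\rfloor$ for $x\in\mathbb R$.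 The rotation number $\rho(f_\pm)\in[0,1)$ is the number such that $F_-^n(x)/n\to\rho(f_\pm)$ and $F_+^n(x)/n\to\rho(f_\pm)$ as $n\to\infty$ for every $x\in\mathbb R$ (the limits exist, coincide and do not depend on $x$). For $\rho,x\in\mathbb R$, $$\phi_\rho(x):=\frac{b}{1-a}+(1-a)\sum_{j=0}^\infty a^j\lfloor x-(j+1)\rho\rfloor,\qquad \psi(\rho):=\phi_\rho(0).$$ For a function $g$ on $\mathbb R$, $g(x-)$ and $g(x+)$ denote the left and right limits at $x$; thus $\psi(\rho+)=\lim_{\rho'\searrow\rho}\psi(\rho')$. *)

theory Defs
  imports Complex_Main
begin

definition frac_plus :: "real \<Rightarrow> real" where
  "frac_plus x = 1 - frac (- x)"

definition f_minus :: "real \<Rightarrow> real \<Rightarrow> real \<Rightarrow> real" where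
  "f_minus a b x = frac (a * x + b)"

definition f_plus :: "real \<Rightarrow> real \<Rightarrow> real \<Rightarrow> real" where
  "f_plus a b x = frac_plus (a * x + b)"

definition f_pm :: "real \<Rightarrow> real \<Rightarrow> real \<Rightarrow> real set" where
  "f_pm a b x = {f_minus a b x, f_plus a b x}"

definition orbit_of :: "real \<Rightarrow> real \<Rightarrow> real \<Rightarrow> (nat \<Rightarrow> real) \<Rightarrow> bool" where
  "orbit_of a b x xs \<longleftrightarrow> x \<in> {0..1} \<and> xs 0 = x \<and> (\<forall>n. xs (Suc n) \<in> f_pm a b (xs n))"

text \<open>The period \<open>q\<close> need not be the least one; a periodic orbit is identified with the
  set \<open>xs ` {..<q}\<close> where convenient.\<close>

definition periodic_orbit :: "real \<Rightarrow> real \<Rightarrow> nat \<Rightarrow> (nat \<Rightarrow> real) \<Rightarrow> bool" where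
  "periodic_orbit a b q xs \<longleftrightarrow>
     q \<ge> 1 \<and> orbit_of a b (xs 0) xs \<and> (\<forall>n. xs (n + q) = xs n)"

text \<open>As the map is multi-valued, an orbit with least period \<open>q\<close> may still revisit a point
  within one period; minimality asks for \<open>q\<close> distinct points.\<close>

definition minimal_periodic_orbit :: "real \<Rightarrow> real \<Rightarrow> nat \<Rightarrow> (nat \<Rightarrow> real) \<Rightarrow> bool" where
  "minimal_periodic_orbit a b q xs \<longleftrightarrow> periodic_orbit a b q xs \<and> inj_on xs {..<q}"

definition F_minus :: "real \<Rightarrow> real \<Rightarrow> real \<Rightarrow> real" where
  "F_minus a b x = a * x + b + (1 - a) * of_int \<lfloor>x\<rfloor>"

definition F_plus :: "real \<Rightarrow> real \<Rightarrow> real \<Rightarrow> real" where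
  "F_plus a b x = a * x + b - (1 - a) * of_int \<lfloor>1 - x\<rfloor>"

text \<open>Meaningful for \<open>0 < a < 1\<close> and \<open>0 \<le> b < 1\<close>, where such a number exists.\<close>

definition rotation_number :: "real \<Rightarrow> real \<Rightarrow> real" where
  "rotation_number a b = (THE r. r \<in> {0..<1} \<and>
     (\<forall>x. (\<lambda>n. (F_minus a b ^^ n) x / real n) \<longlonglongrightarrow> r \<and>
          (\<lambda>n. (F_plus a b ^^ n) x / real n) \<longlonglongrightarrow> r))"

definition phi :: "real \<Rightarrow> real \<Rightarrow> real \<Rightarrow> real \<Rightarrow> real" where
  "phi a b \<rho> x =
     b / (1 - a) + (1 - a) * (\<Sum>j. a ^ j * of_int \<lfloor>x - (real j + 1) * \<rho>\<rfloor>)"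

definition psi :: "real \<Rightarrow> real \<Rightarrow> real \<Rightarrow> real" where
  "psi a b \<rho> = phi a b \<rho> 0"

end

(* psi is antitone and left-continuous with psi(0) >= 0 > psi(1), so it changes sign at some rho in
[0,1): psi(rho) >= 0 >= psi(rho+). As phi_rho(1-) = 1 + psi(rho+), this says that phi_rho maps [0,1)
into [0,1]. The functional equation phi_rho(x + rho) = a phi_rho(x) + b + (1 - a) floor(x) then makes
phi_rho a semiconjugacy from the translation by rho to the lifts F_-, F_+, up to the choice of branch
at integers. Hence rho is the rotation number, and for rho = p/q the orbit of the translation on the
multiples of 1/q is carried to a periodic orbit, injectively because phi_rho jumps at each k/q.

Conversely, a periodic orbit lifts to a sequence between the iterates of F_+ and F_- that advances by
an integer p in q steps, so rho = p/q. If g = gcd(p,q) > 1, compare the orbit with its shift by q/g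
steps and p/g turns: the dynamics preserves order strictly, so unless the two agree they drift apart
monotonically, while after g shifts they must agree. *)

theory Submission
  imports Defs "HOL-Analysis.Uniform_Limit"
begin

section \<open>Weighted series whose coefficients grow at most linearly\<close>

lemma summable_affine_power:
  fixes a A B :: real
  assumes "0 < a" "a < 1"
  shows "summable (\<lambda>j. a ^ j * (A + B * (real j + 1)))"
proof -
  have "summable (\<lambda>j. A * a ^ j + B * (of_nat (Suc j) * a ^ j))"
    using assms by (intro summable_add summable_mult summable_geometric
        sums_summable[OF geometric_deriv_sums]) auto
  then show ?thesis
    by (simp add: algebra_simps)
qed

text \<open>Tannery's theorem with majorant \<open>a ^ j * (A + B * (j + 1))\<close>. The bound may
  grow linearly in \<open>j\<close> because the floors in \<open>phi\<close> do.\<close>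

lemma tendsto_suminf_affine_power:
  fixes a A B :: real
  assumes a: "0 < a" "a < 1" and F: "F \<noteq> bot"
    and lim: "\<And>j. (c j \<longlongrightarrow> d j) F"
    and bound: "eventually (\<lambda>x. \<forall>j. \<bar>c j x\<bar> \<le> A + B * (real j + 1)) F"
  shows "((\<lambda>x. \<Sum>j. a ^ j * c j x) \<longlongrightarrow> (\<Sum>j. a ^ j * d j)) F"
proof -
  have "eventually (\<lambda>(k, x). norm (a ^ k * c k x) \<le> a ^ k * (A + B * (real k + 1)))
      (at_top \<times>\<^sub>F F)"
    unfolding eventually_prod_filter
  proof (intro exI conjI)
    show "eventually (\<lambda>_::nat. True) at_top" by simp
    show "eventually (\<lambda>x. \<forall>j. \<bar>c j x\<bar> \<le> A + B * (real j + 1)) F" by (rule bound)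
  qed (use a in \<open>auto simp: abs_mult intro!: mult_left_mono\<close>)
  from tannerys_theorem[OF _ this summable_affine_power[OF a] F, where b = "\<lambda>k. a ^ k * d k"]
  show ?thesis
    using lim by (simp add: tendsto_mult_left)
qed

lemma eventually_floor_at_left:
  fixes t :: real
  shows "eventually (\<lambda>x. \<lfloor>x\<rfloor> = \<lceil>t\<rceil> - 1) (at_left t)"
proof -
  have "eventually (\<lambda>x. x > of_int (\<lceil>t\<rceil> - 1)) (at_left t)"
    by (rule order_tendstoD[OF tendsto_ident_at]) linarith
  moreover have "eventually (\<lambda>x. x < t) (at_left t)"
    by (simp add: eventually_at_filter)
  ultimately show ?thesis
    by eventually_elim linarith
qed

locale affine_circle_map =
  fixes a b :: real
  assumes a_pos: "0 < a" and a_less_1: "a < 1" and b_nonneg: "0 \<le> b" and b_less_1: "b < 1"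
begin

section \<open>Monotonicity and functional equations of \<open>phi\<close>\<close>

lemma summable_affine_bound:
  assumes "\<And>j. \<bar>c j\<bar> \<le> A + B * (real j + 1)"
  shows "summable (\<lambda>j. a ^ j * c j)"
proof (rule summable_comparison_test)
  show "summable (\<lambda>j. a ^ j * (A + B * (real j + 1)))"
    using a_pos a_less_1 by (rule summable_affine_power)
  show "\<exists>N. \<forall>j\<ge>N. norm (a ^ j * c j) \<le> a ^ j * (A + B * (real j + 1))"
    using a_pos assms by (auto simp: abs_mult intro!: mult_left_mono)
qed

lemma summable_floor_power:
  "summable (\<lambda>j. a ^ j * of_int \<lfloor>x - (real j + 1) * r\<rfloor>)"
proof (rule summable_affine_bound)
  fix j
  have "\<bar>(real j + 1) * r\<bar> = \<bar>r\<bar> * (real j + 1)"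
    by (simp add: abs_mult)
  then show "\<bar>of_int \<lfloor>x - (real j + 1) * r\<rfloor>\<bar> \<le> (\<bar>x\<bar> + 1) + \<bar>r\<bar> * (real j + 1)"
    by linarith
qed

lemma summable_ceiling_power:
  "summable (\<lambda>j. a ^ j * of_int (\<lceil>- ((real j + 1) * r)\<rceil> - 1))"
proof (rule summable_affine_bound)
  fix j
  have "\<bar>(real j + 1) * r\<bar> = \<bar>r\<bar> * (real j + 1)"
    by (simp add: abs_mult)
  then show "\<bar>of_int (\<lceil>- ((real j + 1) * r)\<rceil> - 1)\<bar> \<le> 2 + \<bar>r\<bar> * (real j + 1)"
    by linarith
qed

text \<open>Point and rotation parameter vary together, so that monotonicity of \<open>phi\<close>
  in the point and antitonicity of \<open>psi\<close> are both instances.\<close>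

lemma phi_mono2:
  assumes "\<And>j. x - (real j + 1) * r \<le> y - (real j + 1) * s"
  shows "phi a b r x \<le> phi a b s y"
proof -
  have "(\<Sum>j. a ^ j * of_int \<lfloor>x - (real j + 1) * r\<rfloor>) \<le> (\<Sum>j. a ^ j * of_int \<lfloor>y - (real j + 1) * s\<rfloor>)"
    using a_pos assms by (intro suminf_le summable_floor_power mult_left_mono) (auto simp: floor_mono)
  then show ?thesis
    using a_less_1 by (simp add: phi_def)
qed

lemma phi_mono: "x \<le> y \<Longrightarrow> phi a b r x \<le> phi a b r y"
  by (rule phi_mono2) simp

lemma psi_antimono: "r \<le> s \<Longrightarrow> psi a b s \<le> psi a b r"
  unfolding psi_def by (rule phi_mono2) (auto intro: mult_left_mono)

lemma phi_less:
  assumes "x \<le> y" and "\<lfloor>x - (real i + 1) * r\<rfloor> < \<lfloor>y - (real i + 1) * r\<rfloor>"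
  shows "phi a b r x < phi a b r y"
proof -
  let ?d = "\<lambda>j. a ^ j * of_int \<lfloor>y - (real j + 1) * r\<rfloor> - a ^ j * of_int \<lfloor>x - (real j + 1) * r\<rfloor>"
  have "0 \<le> ?d j" for j
    using a_pos assms(1) by (simp add: floor_mono mult_left_mono)
  moreover have "0 < ?d i"
    using a_pos assms(2) by simp
  ultimately have "0 < suminf ?d"
    by (intro suminf_pos2[of _ i] summable_diff summable_floor_power) auto
  then show ?thesis
    using a_less_1 by (simp add: phi_def suminf_diff[OF summable_floor_power summable_floor_power, symmetric])
qed

text \<open>The integer \<open>m\<close> comes out of every floor, and the weights
  \<open>(1 - a) * a ^ j\<close> sum to 1.\<close>

lemma phi_add_int: "phi a b r (x + of_int m) = phi a b r x + of_int m"
proof -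
  have "(\<Sum>j. a ^ j * of_int \<lfloor>x + of_int m - (real j + 1) * r\<rfloor>)
      = (\<Sum>j. a ^ j * of_int \<lfloor>x - (real j + 1) * r\<rfloor> + a ^ j * of_int m)"
  proof (rule suminf_cong)
    fix j
    have "\<lfloor>x + of_int m - (real j + 1) * r\<rfloor> = \<lfloor>x - (real j + 1) * r\<rfloor> + m"
      by linarith
    then show "a ^ j * of_int \<lfloor>x + of_int m - (real j + 1) * r\<rfloor>
        = a ^ j * of_int \<lfloor>x - (real j + 1) * r\<rfloor> + a ^ j * of_int m"
      by (simp add: algebra_simps)
  qed
  also have "\<dots> = (\<Sum>j. a ^ j * of_int \<lfloor>x - (real j + 1) * r\<rfloor>) + (\<Sum>j. a ^ j * of_int m)"
    using a_pos a_less_1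
    by (intro suminf_add[symmetric] summable_floor_power summable_mult2 summable_geometric) auto
  also have "(\<Sum>j. a ^ j * of_int m) = of_int m / (1 - a)"
    using a_pos a_less_1 by (simp add: suminf_mult2[symmetric] summable_geometric suminf_geometric)
  finally have "phi a b r (x + of_int m) = b / (1 - a) +
      (1 - a) * ((\<Sum>j. a ^ j * of_int \<lfloor>x - (real j + 1) * r\<rfloor>) + of_int m / (1 - a))"
    by (simp only: phi_def)
  then show ?thesis
    using a_less_1 by (simp add: phi_def distrib_left)
qed

text \<open>Translation by \<open>r\<close> shifts the index of the series by one, and the head that
  splits off is \<open>\<lfloor>x\<rfloor>\<close>. The constant \<open>b / (1 - a)\<close> is the
  fixed point of \<open>\<lambda>t. a * t + b\<close>.\<close>

lemma phi_add_rotation: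
  "phi a b r (x + r) = a * phi a b r x + b + (1 - a) * of_int \<lfloor>x\<rfloor>"
proof -
  let ?S = "\<Sum>j. a ^ j * of_int \<lfloor>x - (real j + 1) * r\<rfloor>"
  let ?f = "\<lambda>j. a ^ j * real_of_int \<lfloor>x + r - (real j + 1) * r\<rfloor>"
  have "suminf ?f = ?f 0 + (\<Sum>j. ?f (Suc j))"
    using suminf_split_head[OF summable_floor_power[of "x + r" r]] by simp
  also have "(\<Sum>j. ?f (Suc j)) = (\<Sum>j. a * (a ^ j * of_int \<lfloor>x - (real j + 1) * r\<rfloor>))"
  proof (rule suminf_cong)
    fix j
    have "x + r - (real (Suc j) + 1) * r = x - (real j + 1) * r"
      by (simp add: algebra_simps)
    then show "?f (Suc j) = a * (a ^ j * of_int \<lfloor>x - (real j + 1) * r\<rfloor>)"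
      by (simp only: power_Suc mult.assoc)
  qed
  also have "\<dots> = a * ?S"
    by (rule suminf_mult[OF summable_floor_power])
  finally have "suminf ?f = of_int \<lfloor>x\<rfloor> + a * ?S"
    by simp
  then have "phi a b r (x + r) = b / (1 - a) + (1 - a) * (of_int \<lfloor>x\<rfloor> + a * ?S)"
    by (simp add: phi_def)
  also have "\<dots> = a * (b / (1 - a) + (1 - a) * ?S) + b + (1 - a) * of_int \<lfloor>x\<rfloor>"
    using a_less_1 by (simp add: field_simps)
  finally show ?thesis
    by (simp add: phi_def)
qed

section \<open>One-sided limits of \<open>psi\<close> and its sign change\<close>

definition psi_right :: "real \<Rightarrow> real" where
  "psi_right r = b / (1 - a) + (1 - a) * (\<Sum>j. a ^ j * of_int (\<lceil>- ((real j + 1) * r)\<rceil> - 1))"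

lemma eventually_floor_bound:
  assumes "F \<le> nhds r"
  shows "eventually (\<lambda>x. \<forall>j. \<bar>real_of_int \<lfloor>- ((real j + 1) * x)\<rfloor>\<bar> \<le> 1 + (\<bar>r\<bar> + 1) * (real j + 1)) F"
proof -
  have "((\<lambda>x. \<bar>x\<bar>) \<longlongrightarrow> \<bar>r\<bar>) F"
    using assms by (intro tendsto_rabs) (simp add: filterlim_def)
  then have "eventually (\<lambda>x. \<bar>x\<bar> < \<bar>r\<bar> + 1) F"
    by (rule order_tendstoD) simp
  then show ?thesis
  proof eventually_elim
    case (elim x)
    show ?case
    proof
      fix j
      have "\<bar>(real j + 1) * x\<bar> \<le> (\<bar>r\<bar> + 1) * (real j + 1)"
        using elim by (simp add: abs_mult mult.commute mult_left_mono)
      then show "\<bar>real_of_int \<lfloor>- ((real j + 1) * x)\<rfloor>\<bar> \<le> 1 + (\<bar>r\<bar> + 1) * (real j + 1)"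
        by linarith
    qed
  qed
qed

text \<open>As \<open>x\<close> decreases to \<open>r\<close>, \<open>- ((j + 1) * x)\<close>
  approaches its limit strictly from below, where the floor settles at the ceiling of the limit
  minus 1, even if the limit is an integer. Hence the ceilings in \<open>psi_right\<close>.\<close>

lemma psi_tendsto_right: "(psi a b \<longlongrightarrow> psi_right r) (at_right r)"
proof -
  have "((\<lambda>x. \<Sum>j. a ^ j * of_int \<lfloor>- ((real j + 1) * x)\<rfloor>) \<longlongrightarrow>
      (\<Sum>j. a ^ j * of_int (\<lceil>- ((real j + 1) * r)\<rceil> - 1))) (at_right r)"
  proof (rule tendsto_suminf_affine_power[OF a_pos a_less_1])
    fix j
    have "filterlim (\<lambda>x. - ((real j + 1) * x)) (at_left (- ((real j + 1) * r))) (at_right r)"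
      unfolding filterlim_at
      by (auto intro!: tendsto_intros simp: eventually_at_filter)
    from eventually_compose_filterlim[OF eventually_floor_at_left this]
    show "((\<lambda>x. of_int \<lfloor>- ((real j + 1) * x)\<rfloor>) \<longlongrightarrow> real_of_int (\<lceil>- ((real j + 1) * r)\<rceil> - 1)) (at_right r)"
      by (intro tendsto_eventually) (auto elim: eventually_mono)
  next
    show "eventually (\<lambda>x. \<forall>j. \<bar>real_of_int \<lfloor>- ((real j + 1) * x)\<rfloor>\<bar> \<le> 1 + (\<bar>r\<bar> + 1) * (real j + 1)) (at_right r)"
      by (rule eventually_floor_bound) (simp add: at_within_def)
  qed simp
  then have "((\<lambda>x. b / (1 - a) + (1 - a) * (\<Sum>j. a ^ j * of_int \<lfloor>- ((real j + 1) * x)\<rfloor>)) \<longlongrightarrow> psi_right r)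
      (at_right r)"
    unfolding psi_right_def by (intro tendsto_intros)
  then show ?thesis
    by (simp add: psi_def[abs_def] phi_def)
qed

text \<open>Here the arguments of the floors decrease to their limits, and the floor is continuous
  from the right.\<close>

lemma psi_tendsto_left: "(psi a b \<longlongrightarrow> psi a b r) (at_left r)"
proof -
  have "((\<lambda>x. \<Sum>j. a ^ j * of_int \<lfloor>- ((real j + 1) * x)\<rfloor>) \<longlongrightarrow>
      (\<Sum>j. a ^ j * of_int \<lfloor>- ((real j + 1) * r)\<rfloor>)) (at_left r)"
  proof (rule tendsto_suminf_affine_power[OF a_pos a_less_1])
    fix j
    have "((\<lambda>x. - ((real j + 1) * x)) \<longlongrightarrow> - ((real j + 1) * r)) (at_left r)"
      by (intro tendsto_intros)
    then have "eventually (\<lambda>x. - ((real j + 1) * x) < of_int (\<lfloor>- ((real j + 1) * r)\<rfloor> + 1)) (at_left r)"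
      by (rule order_tendstoD) linarith
    moreover have "eventually (\<lambda>x. - ((real j + 1) * r) < - ((real j + 1) * x)) (at_left r)"
      by (simp add: eventually_at_filter)
    ultimately have "eventually (\<lambda>x. \<lfloor>- ((real j + 1) * x)\<rfloor> = \<lfloor>- ((real j + 1) * r)\<rfloor>) (at_left r)"
      by eventually_elim linarith
    then show "((\<lambda>x. of_int \<lfloor>- ((real j + 1) * x)\<rfloor>) \<longlongrightarrow> real_of_int \<lfloor>- ((real j + 1) * r)\<rfloor>) (at_left r)"
      by (intro tendsto_eventually) (auto elim: eventually_mono)
  next
    show "eventually (\<lambda>x. \<forall>j. \<bar>real_of_int \<lfloor>- ((real j + 1) * x)\<rfloor>\<bar> \<le> 1 + (\<bar>r\<bar> + 1) * (real j + 1)) (at_left r)"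
      by (rule eventually_floor_bound) (simp add: at_within_def)
  qed simp
  then have "((\<lambda>x. b / (1 - a) + (1 - a) * (\<Sum>j. a ^ j * of_int \<lfloor>- ((real j + 1) * x)\<rfloor>)) \<longlongrightarrow>
      b / (1 - a) + (1 - a) * (\<Sum>j. a ^ j * of_int \<lfloor>- ((real j + 1) * r)\<rfloor>)) (at_left r)"
    by (intro tendsto_intros)
  then show ?thesis
    by (simp add: psi_def[abs_def] phi_def)
qed

lemma psi_0_nonneg: "0 \<le> psi a b 0"
  using a_less_1 b_nonneg by (simp add: psi_def phi_def)

text \<open>At rotation 1 the floors are exactly \<open>- (j + 1)\<close>, so the differentiated
  geometric series gives the value \<open>(b - 1) / (1 - a)\<close>.\<close>

lemma psi_1_neg: "psi a b 1 < 0"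
proof -
  have "(\<lambda>j. of_nat (Suc j) * a ^ j) sums (1 / (1 - a)\<^sup>2)"
    using a_pos a_less_1 by (intro geometric_deriv_sums) simp
  then have "(\<lambda>j. - (of_nat (Suc j) * a ^ j)) sums (- (1 / (1 - a)\<^sup>2))"
    by (rule sums_minus)
  moreover have "a ^ j * of_int \<lfloor>0 - (real j + 1) * 1\<rfloor> = - (of_nat (Suc j) * a ^ j)" for j
  proof -
    have "\<lfloor>0 - (real j + 1) * 1\<rfloor> = - int (Suc j)"
      by (simp add: floor_eq_iff)
    then show ?thesis by (simp only: of_int_minus of_int_of_nat_eq mult_minus_right mult.commute)
  qed
  ultimately have "(\<Sum>j. a ^ j * real_of_int \<lfloor>0 - (real j + 1) * 1\<rfloor>) = - (1 / (1 - a)\<^sup>2)"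
    by (simp only: sums_unique[symmetric])
  then have "psi a b 1 = (b - 1) / (1 - a)"
    unfolding psi_def phi_def using a_less_1
    by (simp only: power2_eq_square diff_divide_distrib) simp
  then show ?thesis
    using a_less_1 b_less_1 by (simp add: divide_neg_pos)
qed

text \<open>The supremum of the points of [0,1] with nonnegative \<open>psi\<close> works:
  left-continuity preserves the sign at the supremum, and beyond it \<open>psi\<close> is at most 0,
  hence so is its right limit.\<close>

lemma psi_sign_change:
  obtains r where "0 \<le> r" "r < 1" "0 \<le> psi a b r" "psi_right r \<le> 0"
proof -
  define S where "S = {r. 0 \<le> r \<and> r \<le> 1 \<and> 0 \<le> psi a b r}"
  have "0 \<in> S" and bdd: "bdd_above S"
    using psi_0_nonneg by (auto simp: S_def intro: bdd_aboveI[of _ 1])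
  define r where "r = Sup S"
  have "0 \<le> r"
    unfolding r_def using \<open>0 \<in> S\<close> bdd by (rule cSup_upper)
  have "r \<le> 1"
    unfolding r_def by (rule cSup_least) (use \<open>0 \<in> S\<close> in blast, simp add: S_def)
  have "0 \<le> psi a b r"
  proof (cases "r = 0")
    case False
    have "0 \<le> psi a b s" if s: "s < r" for s
    proof -
      obtain t where "t \<in> S" "s < t"
        using s \<open>0 \<in> S\<close> bdd less_cSup_iff[of S s] unfolding r_def by blast
      then show ?thesis
        using psi_antimono[of s t] by (simp add: S_def)
    qed
    then have "eventually (\<lambda>s. 0 \<le> psi a b s) (at_left r)"
      by (simp add: eventually_at_filter)
    then show ?thesis
      by (rule tendsto_lowerbound[OF psi_tendsto_left]) simp
  qed (use psi_0_nonneg in simp)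
  moreover have "r < 1"
    using \<open>r \<le> 1\<close> \<open>0 \<le> psi a b r\<close> psi_1_neg by (cases "r = 1") auto
  moreover have "psi_right r \<le> 0"
  proof -
    have "psi a b s \<le> 0" if "r < s" for s
    proof (cases "s \<le> 1")
      case True
      then have "s \<notin> S"
        using that cSup_upper[OF _ bdd] unfolding r_def by force
      then show ?thesis
        using True that \<open>0 \<le> r\<close> by (auto simp: S_def)
    next
      case False
      then show ?thesis
        using psi_antimono[of 1 s] psi_1_neg by simp
    qed
    then have "eventually (\<lambda>s. psi a b s \<le> 0) (at_right r)"
      by (simp add: eventually_at_filter)
    then show ?thesis
      by (rule tendsto_upperbound[OF psi_tendsto_right]) simp
  qed
  ultimately show thesis
    using \<open>0 \<le> r\<close> that by blast
qed

text \<open>\<open>\<lceil>t\<rceil> - 1\<close> is the largest integer strictly below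
  \<open>t\<close>, so it bounds the floor of \<open>x - 1 + t\<close> for \<open>x < 1\<close>.
  Integer translation turns the bound at \<open>x - 1\<close> into one at \<open>x\<close>.\<close>

lemma phi_le_psi_right:
  assumes "x < 1"
  shows "phi a b r x \<le> 1 + psi_right r"
proof -
  have "phi a b r (x - 1) \<le> psi_right r"
  proof -
    have "(\<Sum>j. a ^ j * of_int \<lfloor>x - 1 - (real j + 1) * r\<rfloor>)
        \<le> (\<Sum>j. a ^ j * of_int (\<lceil>- ((real j + 1) * r)\<rceil> - 1))"
    proof (intro suminf_le summable_floor_power summable_ceiling_power mult_left_mono)
      fix j
      have "\<lfloor>x - 1 - (real j + 1) * r\<rfloor> \<le> \<lceil>- ((real j + 1) * r)\<rceil> - 1"
        using assms by linarith
      then show "real_of_int \<lfloor>x - 1 - (real j + 1) * r\<rfloor> \<le> of_int (\<lceil>- ((real j + 1) * r)\<rceil> - 1)"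
        by (simp only: of_int_le_iff)
    qed (use a_pos in simp)
    then show ?thesis
      using a_less_1 by (simp add: phi_def psi_right_def)
  qed
  then show ?thesis
    using phi_add_int[of r "x - 1" 1] by simp
qed

section \<open>Comparison of orbits of the two lifts\<close>

lemma F_minus_strict_mono: "x < y \<Longrightarrow> F_minus a b x < F_minus a b y"
  unfolding F_minus_def using a_pos a_less_1
  by (intro add_less_le_mono mult_left_mono mult_strict_left_mono) (auto simp: floor_mono)

lemma F_plus_strict_mono: "x < y \<Longrightarrow> F_plus a b x < F_plus a b y"
proof -
  assume "x < y"
  then have "a * x < a * y" "(1 - a) * of_int \<lfloor>1 - y\<rfloor> \<le> (1 - a) * of_int \<lfloor>1 - x\<rfloor>"
    using a_pos a_less_1 by (auto intro!: mult_left_mono simp: floor_mono)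
  then show ?thesis
    by (simp add: F_plus_def)
qed

text \<open>Despite the names, \<open>F_plus\<close> lies below \<open>F_minus\<close>, by
  \<open>1 - a\<close> at the integers. A strict gap between the arguments reverses the order: the
  largest integer strictly below \<open>y\<close> is at least \<open>\<lfloor>x\<rfloor>\<close>,
  and the slope \<open>a\<close> gives strictness.\<close>

lemma F_minus_less_F_plus:
  assumes "x < y"
  shows "F_minus a b x < F_plus a b y"
proof -
  have "\<lfloor>x\<rfloor> \<le> - \<lfloor>1 - y\<rfloor>"
    using assms by linarith
  then have "(1 - a) * of_int \<lfloor>x\<rfloor> \<le> (1 - a) * of_int (- \<lfloor>1 - y\<rfloor>)"
    using a_less_1 by (intro mult_left_mono) (simp_all only: of_int_le_iff)
  moreover have "a * x < a * y"
    using a_pos assms by simp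
  ultimately show ?thesis
    by (simp add: F_minus_def F_plus_def)
qed

lemma F_minus_funpow_mono: "x \<le> y \<Longrightarrow> (F_minus a b ^^ n) x \<le> (F_minus a b ^^ n) y"
  by (induction n) (auto simp: le_less F_minus_strict_mono)

lemma F_plus_funpow_mono: "x \<le> y \<Longrightarrow> (F_plus a b ^^ n) x \<le> (F_plus a b ^^ n) y"
  by (induction n) (auto simp: le_less F_plus_strict_mono)

lemma F_minus_funpow_less_F_plus_funpow: "x < y \<Longrightarrow> (F_minus a b ^^ n) x < (F_plus a b ^^ n) y"
  by (induction n) (auto simp: F_minus_less_F_plus)

lemma F_plus_mono: "x \<le> y \<Longrightarrow> F_plus a b x \<le> F_plus a b y"
  using F_plus_funpow_mono[of x y 1] by simp

lemma F_minus_mono: "x \<le> y \<Longrightarrow> F_minus a b x \<le> F_minus a b y"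
  using F_minus_funpow_mono[of x y 1] by simp

text \<open>A lift of an orbit of the multi-valued map only satisfies these two inequalities, since it
  may use either branch at an integer.\<close>

lemma funpow_between:
  assumes "\<And>n. F_plus a b (y n) \<le> y (Suc n)" "\<And>n. y (Suc n) \<le> F_minus a b (y n)"
  shows "(F_plus a b ^^ n) (y 0) \<le> y n" "y n \<le> (F_minus a b ^^ n) (y 0)"
proof (induction n)
  case (Suc n)
  { case 1 then show ?case using F_plus_mono[OF Suc(1)] assms(1)[of n] by simp }
  { case 2 then show ?case using F_minus_mono[OF Suc(2)] assms(2)[of n] by simp }
qed simp_all

text \<open>\<open>F_minus\<close> uses the largest integer at most \<open>u + m\<close>, which is
  at least \<open>m\<close>; \<open>F_plus\<close> uses the largest integer strictly below
  \<open>u + m\<close>, which is at most \<open>m\<close>, even for \<open>u = 1\<close>.\<close>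

lemma F_between:
  assumes "0 \<le> u" "u \<le> 1"
  shows "F_plus a b (u + of_int m) \<le> a * u + b + of_int m"
    and "a * u + b + of_int m \<le> F_minus a b (u + of_int m)"
proof -
  have "- m \<le> \<lfloor>1 - (u + of_int m)\<rfloor>"
    using assms by linarith
  then have "(1 - a) * of_int (- m) \<le> (1 - a) * of_int \<lfloor>1 - (u + of_int m)\<rfloor>"
    using a_less_1 by (intro mult_left_mono) (simp_all only: of_int_le_iff)
  then show "F_plus a b (u + of_int m) \<le> a * u + b + of_int m"
    by (simp add: F_plus_def algebra_simps)
  have "m \<le> \<lfloor>u + of_int m\<rfloor>"
    using assms by linarith
  then have "(1 - a) * of_int m \<le> (1 - a) * of_int \<lfloor>u + of_int m\<rfloor>"
    using a_less_1 by (intro mult_left_mono) (simp_all only: of_int_le_iff)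
  then show "a * u + b + of_int m \<le> F_minus a b (u + of_int m)"
    by (simp add: F_minus_def algebra_simps)
qed

section \<open>Identification of the rotation number by the sign of \<open>psi\<close>\<close>

definition is_rotation_number :: "real \<Rightarrow> bool" where
  "is_rotation_number r \<longleftrightarrow> r \<in> {0..<1} \<and>
     (\<forall>x. (\<lambda>n. (F_minus a b ^^ n) x / real n) \<longlonglongrightarrow> r \<and>
          (\<lambda>n. (F_plus a b ^^ n) x / real n) \<longlonglongrightarrow> r)"

lemma phi_bounds:
  assumes "0 \<le> psi a b r" "psi_right r \<le> 0" "0 \<le> x" "x < 1"
  shows "0 \<le> phi a b r x" "phi a b r x \<le> 1"
  using phi_le_psi_right[of x r] phi_mono[of 0 x r] assms by (auto simp: psi_def)

lemma tendsto_of_bounded_linear_deviation: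
  fixes g :: "nat \<Rightarrow> real"
  assumes "\<And>n. \<bar>g n - real n * r\<bar> \<le> K"
  shows "(\<lambda>n. g n / real n) \<longlonglongrightarrow> r"
proof (rule LIM_zero_cancel, rule Lim_null_comparison)
  show "(\<lambda>n. K / real n) \<longlonglongrightarrow> 0"
    by (rule lim_const_over_n)
  show "eventually (\<lambda>n. norm (g n / real n - r) \<le> K / real n) sequentially"
    using eventually_gt_at_top[of 0]
  proof eventually_elim
    case (elim n)
    then have "g n / real n - r = (g n - real n * r) / real n"
      by (simp add: field_simps)
    then show ?case
      using assms[of n] elim by (simp add: divide_right_mono)
  qed
qed

text \<open>Since \<open>phi\<close> differs from the identity by at most 1, it carries translation
  by \<open>r\<close> to sequences that stay close to \<open>x + n * r\<close>. Trapping a point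
  between two such sequences keeps its iterates within a bounded distance of
  \<open>n * r\<close>.\<close>

lemma is_rotation_numberI:
  assumes r: "0 \<le> r" "r < 1" and psi: "0 \<le> psi a b r" "psi_right r \<le> 0"
  shows "is_rotation_number r"
proof -
  have frac_decomp: "phi a b r x = phi a b r (frac x) + of_int \<lfloor>x\<rfloor>" for x
    using phi_add_int[of r "frac x" "\<lfloor>x\<rfloor>"] by (simp add: frac_def)
  have bounds: "0 \<le> phi a b r (frac x)" "phi a b r (frac x) \<le> 1" for x
    using phi_bounds[OF psi] by (simp_all add: frac_lt_1)
  have step: "F_plus a b (phi a b r x) \<le> phi a b r (x + r)"
             "phi a b r (x + r) \<le> F_minus a b (phi a b r x)" for x
  proof -
    have "phi a b r (x + r) = a * phi a b r (frac x) + b + of_int \<lfloor>x\<rfloor>"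
      unfolding phi_add_rotation frac_decomp[of x] by (simp add: algebra_simps)
    then show "F_plus a b (phi a b r x) \<le> phi a b r (x + r)"
             "phi a b r (x + r) \<le> F_minus a b (phi a b r x)"
      using F_between[OF bounds, of x "\<lfloor>x\<rfloor>"] by (simp_all flip: frac_decomp)
  qed
  have iter: "(F_plus a b ^^ n) (phi a b r x) \<le> phi a b r (x + real n * r)"
             "phi a b r (x + real n * r) \<le> (F_minus a b ^^ n) (phi a b r x)" for n x
  proof -
    let ?y = "\<lambda>n. phi a b r (x + real n * r)"
    have "F_plus a b (?y n) \<le> ?y (Suc n)" "?y (Suc n) \<le> F_minus a b (?y n)" for n
      using step[of "x + real n * r"] by (simp_all add: algebra_simps)
    from funpow_between[of ?y, OF this]
    show "(F_plus a b ^^ n) (phi a b r x) \<le> ?y n" "?y n \<le> (F_minus a b ^^ n) (phi a b r x)"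
      by simp_all
  qed
  have near: "x - 1 \<le> phi a b r x" "phi a b r x \<le> x + 1" for x
    using frac_decomp[of x] bounds[of x] by linarith+
  have "\<exists>K. \<forall>n. \<bar>(F_minus a b ^^ n) y - real n * r\<bar> \<le> K \<and> \<bar>(F_plus a b ^^ n) y - real n * r\<bar> \<le> K" for y
  proof -
    \<comment> \<open>By \<open>near\<close>, \<open>phi\<close> at \<open>k\<close> is at least
      \<open>\<bar>y\<bar> + 1\<close>, and symmetrically at \<open>- k\<close>.\<close>
    define k where "k = \<bar>y\<bar> + 2"
    have k: "phi a b r (- k) < y" "y < phi a b r k"
      using near[of k] near[of "- k"] unfolding k_def by linarith+
    have "\<bar>(F_minus a b ^^ n) y - real n * r\<bar> \<le> k + 1 \<and> \<bar>(F_plus a b ^^ n) y - real n * r\<bar> \<le> k + 1" for n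
    proof -
      \<comment> \<open>\<open>iter\<close> bounds only \<open>F_plus\<close> from above and only
        \<open>F_minus\<close> from below. The two opposite bounds need the strict comparison of the
        lifts.\<close>
      have up: "(F_minus a b ^^ n) y \<le> k + real n * r + 1"
        using F_minus_funpow_less_F_plus_funpow[OF k(2), of n] iter(1)[of n k] near(2)[of "k + real n * r"]
        by linarith
      have low: "- k + real n * r - 1 \<le> (F_plus a b ^^ n) y"
        using F_minus_funpow_less_F_plus_funpow[OF k(1), of n] iter(2)[of "- k" n] near(1)[of "- k + real n * r"]
        by linarith
      have up': "(F_plus a b ^^ n) y \<le> k + real n * r + 1"
        using F_plus_funpow_mono[of y "phi a b r k" n] k(2) iter(1)[of n k] near(2)[of "k + real n * r"]
        by linarith
      have low': "- k + real n * r - 1 \<le> (F_minus a b ^^ n) y"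
        using F_minus_funpow_mono[of "phi a b r (- k)" y n] k(1) iter(2)[of "- k" n] near(1)[of "- k + real n * r"]
        by linarith
      show ?thesis
        using up low up' low' by linarith
    qed
    then show ?thesis by blast
  qed
  then have "(\<lambda>n. (F_minus a b ^^ n) y / real n) \<longlonglongrightarrow> r \<and> (\<lambda>n. (F_plus a b ^^ n) y / real n) \<longlonglongrightarrow> r" for y
    using tendsto_of_bounded_linear_deviation[of "\<lambda>n. (F_minus a b ^^ n) y"]
      tendsto_of_bounded_linear_deviation[of "\<lambda>n. (F_plus a b ^^ n) y"] by blast
  then show ?thesis
    using r by (simp add: is_rotation_number_def)
qed

lemma is_rotation_number_unique:
  "is_rotation_number r \<Longrightarrow> is_rotation_number s \<Longrightarrow> r = s"
  unfolding is_rotation_number_def by (meson LIMSEQ_unique)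

text \<open>Uniqueness identifies the sign change of \<open>psi\<close> with the number chosen by
  \<open>THE\<close>, which thus inherits both inequalities.\<close>

lemma is_rotation_number_rotation_number: "is_rotation_number (rotation_number a b)"
  and rotation_number_psi_nonneg: "0 \<le> psi a b (rotation_number a b)"
  and rotation_number_psi_right: "psi_right (rotation_number a b) \<le> 0"
proof -
  obtain r where r: "0 \<le> r" "r < 1" "0 \<le> psi a b r" "psi_right r \<le> 0"
    by (rule psi_sign_change)
  have "is_rotation_number r"
    using r by (rule is_rotation_numberI)
  moreover have "rotation_number a b = (THE r. is_rotation_number r)"
    unfolding rotation_number_def is_rotation_number_def ..
  ultimately have "rotation_number a b = r"
    using is_rotation_number_unique by (auto intro!: the_equality)
  then show "is_rotation_number (rotation_number a b)" "0 \<le> psi a b (rotation_number a b)"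
      "psi_right (rotation_number a b) \<le> 0"
    using r \<open>is_rotation_number r\<close> by simp_all
qed

section \<open>Orbits of the multi-valued map as congruences modulo 1\<close>

lemma f_pm_iff:
  "v \<in> f_pm a b u \<longleftrightarrow> v \<in> {0..1} \<and> (\<exists>m::int. v = a * u + b - of_int m)"
proof
  assume "v \<in> f_pm a b u"
  then consider "v = frac (a * u + b)" | "v = 1 - frac (- (a * u + b))"
    by (auto simp: f_pm_def f_minus_def f_plus_def frac_plus_def)
  then show "v \<in> {0..1} \<and> (\<exists>m::int. v = a * u + b - of_int m)"
  proof cases
    case 1
    then have "v = a * u + b - of_int \<lfloor>a * u + b\<rfloor>"
      by (simp add: frac_def)
    then show ?thesis
      using 1 frac_lt_1[of "a * u + b"] frac_ge_0[of "a * u + b"] by auto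
  next
    case 2
    \<comment> \<open>The subtracted integer is the largest one strictly below
      \<open>a * u + b\<close>.\<close>
    then have "v = a * u + b - of_int (- 1 - \<lfloor>- (a * u + b)\<rfloor>)"
      by (simp add: frac_def)
    then show ?thesis
      using 2 frac_lt_1[of "- (a * u + b)"] frac_ge_0[of "- (a * u + b)"]
      by (intro conjI exI) (simp_all only: atLeastAtMost_iff, linarith)
  qed
next
  assume "v \<in> {0..1} \<and> (\<exists>m::int. v = a * u + b - of_int m)"
  then obtain m :: int where v: "0 \<le> v" "v \<le> 1" "a * u + b = v + of_int m"
    by force
  show "v \<in> f_pm a b u"
  \<comment> \<open>The value 1 is reached only by \<open>f_plus\<close>, at an integer argument of
    the fractional part; any other value lies in [0,1) and comes from
    \<open>f_minus\<close>.\<close>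
  proof (cases "v = 1")
    case True
    then have "a * u + b = of_int (m + 1)"
      using v by simp
    then have "- (a * u + b) \<in> \<int>"
      by (metis Ints_minus Ints_of_int)
    then have "f_plus a b u = v"
      using True by (simp add: f_plus_def frac_plus_def)
    then show ?thesis
      by (simp add: f_pm_def)
  next
    case False
    then have "\<lfloor>a * u + b\<rfloor> = m"
      using v by (intro floor_unique) auto
    then have "f_minus a b u = v"
      using v by (simp add: f_minus_def frac_def)
    then show ?thesis
      by (simp add: f_pm_def)
  qed
qed

text \<open>Replaces the choice of a branch by a congruence. \<open>orbit_of\<close> bounds the
  initial point only; later points are in range as values of \<open>f_pm\<close>.\<close>

lemma orbit_of_iff:
  "orbit_of a b (xs 0) xs \<longleftrightarrow>
    (\<forall>n. xs n \<in> {0..1}) \<and> (\<forall>n. \<exists>m::int. xs (Suc n) = a * xs n + b - of_int m)"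
proof
  assume *: "orbit_of a b (xs 0) xs"
  moreover have "xs n \<in> {0..1}" for n
  proof (cases n)
    case (Suc k)
    then show ?thesis
      using * unfolding orbit_of_def f_pm_iff by blast
  qed (use * in \<open>simp add: orbit_of_def\<close>)
  ultimately show "(\<forall>n. xs n \<in> {0..1}) \<and> (\<forall>n. \<exists>m::int. xs (Suc n) = a * xs n + b - of_int m)"
    unfolding orbit_of_def f_pm_iff by blast
qed (auto simp: orbit_of_def f_pm_iff)

end

section \<open>Multiples of \<open>p\<close> modulo \<open>q\<close> and the orbit for a rational
  rotation number\<close>

lemma frac_of_int_divide: "frac (of_int k / real q) = of_int (k mod int q) / real q"
proof (cases "q = 0")
  case False
  have "\<lfloor>of_int k / real q\<rfloor> = k div int q"
    using floor_divide_of_int_eq[of k "int q"] by simp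
  moreover have "real_of_int k = of_int (k div int q) * real q + of_int (k mod int q)"
    by (metis div_mult_mod_eq of_int_add of_int_mult of_int_of_nat_eq)
  ultimately show ?thesis
    using False by (simp add: frac_def field_simps)
qed simp

lemma bij_betw_mult_mod:
  fixes p :: int
  assumes "coprime p (int q)" "q \<ge> 1"
  shows "bij_betw (\<lambda>n. nat ((int n * p) mod int q)) {..<q} {..<q}"
proof -
  let ?h = "\<lambda>n. nat ((int n * p) mod int q)"
  have "inj_on ?h {..<q}"
  proof (rule inj_onI)
    fix n m
    assume nm: "n \<in> {..<q}" "m \<in> {..<q}" and "?h n = ?h m"
    then have "(int n * p) mod int q = (int m * p) mod int q"
      using assms(2) by (simp add: nat_eq_iff)
    then have "int q dvd (int n - int m) * p"
      by (simp add: mod_eq_dvd_iff left_diff_distrib)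
    then have "int q dvd int n - int m"
      using assms(1) by (simp add: coprime_dvd_mult_left_iff coprime_commute)
    then have "int n mod int q = int m mod int q"
      by (simp add: mod_eq_dvd_iff)
    then show "n = m"
      using nm by simp
  qed
  moreover have "?h ` {..<q} \<subseteq> {..<q}"
    using assms(2) by (auto simp: nat_less_iff)
  ultimately show ?thesis
    by (simp add: bij_betw_def endo_inj_surj)
qed

context affine_circle_map
begin

text \<open>As \<open>p\<close> is invertible modulo \<open>q\<close>, some floor in the series at
  \<open>k / q\<close> has an integer argument, so that term drops at every smaller point.\<close>

lemma phi_strict_at_jump:
  fixes p :: int
  assumes "coprime p (int q)" "q \<ge> 1" "k < q" and x: "x < real k / real q"
  shows "phi a b (of_int p / real q) x < phi a b (of_int p / real q) (real k / real q)"
proof -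
  obtain n where "nat ((int n * p) mod int q) = k"
    using bij_betw_imp_surj_on[OF bij_betw_mult_mod[OF assms(1,2)]] assms(3) by (metis (no_types, lifting) imageE lessThan_iff)
  then have "(int n * p) mod int q = int k"
    using assms(2) by auto
  then have "int n * p = int q * ((int n * p) div int q) + int k"
    by (metis mult_div_mod_eq)
  then obtain d where "int n * p = int q * d + int k" ..
  then have d: "real n * of_int p = real q * of_int d + real k"
    by (metis of_int_add of_int_mult of_int_of_nat_eq)
  \<comment> \<open>The index must satisfy \<open>i + 1 = n\<close> modulo \<open>q\<close>. Adding
    \<open>q\<close> covers \<open>n = 0\<close> and changes the argument of the floor only by the
    integer \<open>p\<close>.\<close>
  define i where "i = n + q - 1"
  have "real i + 1 = real n + real q"
    using assms(2) by (simp add: i_def)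
  then have y: "real k / real q - (real i + 1) * (of_int p / real q) = of_int (- d - p)"
    using d assms(2) by (simp add: field_simps)
  show ?thesis
  proof (rule phi_less[of _ _ i])
    have "x - (real i + 1) * (of_int p / real q) < of_int (- d - p)"
      using x y by linarith
    then show "\<lfloor>x - (real i + 1) * (of_int p / real q)\<rfloor>
        < \<lfloor>real k / real q - (real i + 1) * (of_int p / real q)\<rfloor>"
      unfolding y floor_of_int by (simp only: floor_less_iff)
  qed (use x in simp)
qed

text \<open>On multiples of \<open>1 / q\<close>, moving left by \<open>1 / q\<close> turns
  \<open>m / q\<close> into a point whose floor is \<open>\<lceil>m / q\<rceil> - 1\<close>, so the
  series at \<open>- 1 / q\<close> is termwise that of \<open>psi_right\<close>.\<close>

lemma phi_last_eq_psi_right: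
  fixes p :: int
  assumes "q \<ge> 1"
  shows "phi a b (of_int p / real q) ((real q - 1) / real q) = 1 + psi_right (of_int p / real q)"
proof -
  have "\<lfloor>- 1 / real q - (real j + 1) * (of_int p / real q)\<rfloor> = \<lceil>- ((real j + 1) * (of_int p / real q))\<rceil> - 1" for j
  proof -
    define m where "m = - ((int j + 1) * p)"
    define c where "c = \<lceil>of_int m / real q\<rceil>"
    have m: "- ((real j + 1) * (of_int p / real q)) = of_int m / real q"
      by (simp add: m_def)
    have "of_int c - 1 < of_int m / real q" "of_int m / real q \<le> of_int c"
      unfolding c_def by linarith+
    then have "of_int ((c - 1) * int q) < real_of_int m" "real_of_int m \<le> of_int (c * int q)"
      using assms by (simp_all add: field_simps)
    then have "(c - 1) * int q < m" "m \<le> c * int q"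
      by (simp_all only: of_int_less_iff of_int_le_iff)
    \<comment> \<open>Integrality of \<open>m\<close> turns strict bounds on \<open>m\<close> into
      weak ones on \<open>m - 1\<close> and conversely.\<close>
    then have "(c - 1) * int q \<le> m - 1" "m - 1 < c * int q"
      by simp_all
    then have "of_int ((c - 1) * int q) \<le> real_of_int (m - 1)" "real_of_int (m - 1) < of_int (c * int q)"
      by (simp_all only: of_int_less_iff of_int_le_iff)
    then have "\<lfloor>of_int (m - 1) / real q\<rfloor> = c - 1"
      using assms by (intro floor_unique) (simp_all add: field_simps)
    moreover have "- 1 / real q - (real j + 1) * (of_int p / real q) = of_int (m - 1) / real q"
      using m by (simp add: diff_divide_distrib)
    ultimately show ?thesis
      by (simp only: m c_def)
  qed
  then have "phi a b (of_int p / real q) (- 1 / real q) = psi_right (of_int p / real q)"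
    by (simp only: phi_def psi_right_def)
  moreover have "(real q - 1) / real q = - 1 / real q + of_int 1"
    using assms by (simp add: field_simps)
  ultimately show ?thesis
    by (simp only: phi_add_int)
qed

lemma rational_rotation_orbit:
  fixes p :: int and q :: nat
  defines "\<rho> \<equiv> rotation_number a b"
  assumes q: "q \<ge> 1" and cop: "coprime p (int q)" and \<rho>: "\<rho> = of_int p / real q"
  defines "xs \<equiv> \<lambda>n. phi a b \<rho> (frac (real n * \<rho>))"
  shows "minimal_periodic_orbit a b q xs"
    and "xs ` {..<q} = (\<lambda>k. phi a b \<rho> (real k / real q)) ` {..<q}"
proof -
  let ?h = "\<lambda>n. nat ((int n * p) mod int q)"
  have xs_h: "xs n = phi a b \<rho> (real (?h n) / real q)" for n
  proof -
    have "real n * \<rho> = of_int (int n * p) / real q"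
      by (simp add: \<rho>)
    then have "frac (real n * \<rho>) = real (?h n) / real q"
      using q by (simp only: frac_of_int_divide) simp
    then show ?thesis
      by (simp only: xs_def)
  qed
  have h: "bij_betw ?h {..<q} {..<q}"
    using cop q by (rule bij_betw_mult_mod)
  have "xs ` {..<q} = (\<lambda>k. phi a b \<rho> (real k / real q)) ` ?h ` {..<q}"
    unfolding image_image by (rule image_cong) (simp_all only: xs_h)
  then show "xs ` {..<q} = (\<lambda>k. phi a b \<rho> (real k / real q)) ` {..<q}"
    by (simp only: bij_betw_imp_surj_on[OF h])
  have "strict_mono_on {..<q} (\<lambda>k. phi a b \<rho> (real k / real q))"
    using cop q unfolding \<rho> by (intro strict_mono_onI phi_strict_at_jump) (auto simp: divide_strict_right_mono)
  then have "inj_on ((\<lambda>k. phi a b \<rho> (real k / real q)) \<circ> ?h) {..<q}"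
    by (intro comp_inj_on bij_betw_imp_inj_on[OF h])
      (simp add: bij_betw_imp_surj_on[OF h] strict_mono_on_imp_inj_on)
  then have "inj_on xs {..<q}"
    by (simp add: xs_h[abs_def] comp_def)
  moreover have "periodic_orbit a b q xs"
    unfolding periodic_orbit_def orbit_of_iff
  proof (intro conjI allI)
    show "xs n \<in> {0..1}" for n
      using phi_bounds[OF rotation_number_psi_nonneg rotation_number_psi_right]
      by (simp add: xs_def \<rho>_def frac_lt_1)
    show "\<exists>m::int. xs (Suc n) = a * xs n + b - of_int m" for n
    proof -
      \<comment> \<open>The number of integers passed when the translation orbit of 0 moves from
        step \<open>n\<close> to \<open>Suc n\<close>.\<close>
      define m where "m = \<lfloor>real (Suc n) * \<rho>\<rfloor> - \<lfloor>real n * \<rho>\<rfloor>"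
      have "frac (real n * \<rho>) + \<rho> = frac (real (Suc n) * \<rho>) + of_int m"
        by (simp add: frac_def m_def algebra_simps)
      then have "phi a b \<rho> (frac (real n * \<rho>) + \<rho>) = xs (Suc n) + of_int m"
        by (simp only: phi_add_int xs_def)
      moreover have "\<lfloor>frac (real n * \<rho>)\<rfloor> = 0"
        by (simp add: floor_eq_iff frac_lt_1)
      ultimately show ?thesis
        by (intro exI[of _ m]) (simp add: phi_add_rotation xs_def)
    qed
    show "xs (n + q) = xs n" for n
      by (simp add: xs_h distrib_right)
  qed (rule q)
  ultimately show "minimal_periodic_orbit a b q xs"
    by (simp add: minimal_periodic_orbit_def)
qed

text \<open>\<open>phi\<close> is constant on \<open>[(q - 1) / q, 1)\<close>: monotonicity bounds
  it below by its value at the left end, which is also the upper bound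
  \<open>1 + psi_right\<close>.\<close>

lemma phi_tendsto_left_1:
  fixes p :: int
  assumes "q \<ge> 1"
  shows "(phi a b (of_int p / real q) \<longlongrightarrow> phi a b (of_int p / real q) ((real q - 1) / real q)) (at_left 1)"
proof (rule tendsto_eventually)
  let ?r = "of_int p / real q"
  have "(real q - 1) / real q < 1"
    using assms by simp
  from eventually_at_left_real[OF this]
  show "eventually (\<lambda>x. phi a b ?r x = phi a b ?r ((real q - 1) / real q)) (at_left 1)"
  proof eventually_elim
    case (elim x)
    then show ?case
      using phi_mono[of "(real q - 1) / real q" x ?r] phi_le_psi_right[of x ?r]
        phi_last_eq_psi_right[OF assms, of p] by simp
  qed
qed

end

section \<open>Lifts of periodic orbits and coprimality of winding and period\<close>

locale periodic_orbit_lift = affine_circle_map +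
  fixes q :: nat and xs :: "nat \<Rightarrow> real"
  assumes periodic: "periodic_orbit a b q xs"
begin

lemma q_ge_1: "q \<ge> 1"
  using periodic by (simp add: periodic_orbit_def)

lemma xs_add_period: "xs (n + q) = xs n"
  using periodic by (simp add: periodic_orbit_def)

lemma xs_bounds: "0 \<le> xs n" "xs n \<le> 1"
  using periodic by (auto simp: periodic_orbit_def orbit_of_iff)

text \<open>The integers discarded by the orbit in its first \<open>n\<close> steps; each floor is
  taken of an integer. Thus \<open>xs n + winding n\<close> is a lift of the orbit.\<close>

definition winding :: "nat \<Rightarrow> int" where
  "winding n = (\<Sum>i<n. \<lfloor>a * xs i + b - xs (Suc i)\<rfloor>)"

lemma winding_0: "winding 0 = 0"
  by (simp add: winding_def)

lemma winding_Suc: "xs (Suc n) + of_int (winding (Suc n)) = a * xs n + b + of_int (winding n)"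
proof -
  obtain m :: int where "xs (Suc n) = a * xs n + b - of_int m"
    using periodic unfolding periodic_orbit_def orbit_of_iff by blast
  then show ?thesis
    by (simp add: winding_def)
qed

lemma winding_add_period: "winding (n + q) = winding n + winding q"
proof (induction n)
  case (Suc n)
  then show ?case
    using xs_add_period[of "Suc n"] by (simp add: winding_def xs_add_period)
qed (simp add: winding_def)

lemma winding_mult_period: "winding (k * q) = int k * winding q"
  by (induction k) (simp_all add: winding_0 winding_add_period[of "_ * q"] add.commute[of q] distrib_right)

lemma xs_mult_period: "xs (k * q) = xs 0"
  by (induction k) (simp_all add: xs_add_period add.commute[of q])

text \<open>The lifted orbit lies between iterates of the two lifts, so it has the same growth rate;
  this is read off along multiples of \<open>q\<close>.\<close>

lemma rotation_number_eq_winding: "rotation_number a b = of_int (winding q) / real q"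
proof -
  let ?r = "rotation_number a b"
  define y where "y n = xs n + of_int (winding n)" for n
  have "F_plus a b (y n) \<le> y (Suc n)" "y (Suc n) \<le> F_minus a b (y n)" for n
    using F_between[OF xs_bounds, of n "winding n"] by (simp_all add: y_def winding_Suc)
  note y_between = funpow_between[of y, OF this]
  have lim: "(\<lambda>n. (F_minus a b ^^ n) (y 0) / real n) \<longlonglongrightarrow> ?r"
      "(\<lambda>n. (F_plus a b ^^ n) (y 0) / real n) \<longlonglongrightarrow> ?r"
    using is_rotation_number_rotation_number unfolding is_rotation_number_def by blast+
  have "(\<lambda>n. y n / real n) \<longlonglongrightarrow> ?r"
    by (rule tendsto_sandwich[OF _ _ lim(2) lim(1)])
      (simp_all add: y_between divide_right_mono)
  moreover have "strict_mono (\<lambda>k. k * q)"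
    using q_ge_1 by (simp add: strict_mono_def)
  ultimately have "(\<lambda>k. y (k * q) / real (k * q)) \<longlonglongrightarrow> ?r"
    using LIMSEQ_subseq_LIMSEQ by (fastforce simp: comp_def)
  then have "(\<lambda>k. y (k * q) / real q / real k) \<longlonglongrightarrow> ?r"
    by (simp add: mult.commute)
  moreover have "(\<lambda>k. y (k * q) / real q / real k) \<longlonglongrightarrow> of_int (winding q) / real q"
  proof (rule tendsto_of_bounded_linear_deviation)
    show "\<bar>y (k * q) / real q - real k * (of_int (winding q) / real q)\<bar> \<le> \<bar>xs 0 / real q\<bar>" for k
      by (simp add: y_def xs_mult_period winding_mult_period add_divide_distrib)
  qed
  ultimately show ?thesis
    by (rule LIMSEQ_unique)
qed

text \<open>Since \<open>a < 1\<close>, the number \<open>a * xs n + winding n\<close> encodes the lexicographic order on the pairs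
  \<open>(winding n, xs n)\<close>. The points \<open>xs n + winding n\<close> of the lifted orbit do not: they identify the
  end point 1 of one unit interval with the end point 0 of the next.\<close>

definition lex_code :: "nat \<Rightarrow> real" where
  "lex_code n = a * xs n + of_int (winding n)"

text \<open>Up to the constant \<open>b\<close>, the code at \<open>n\<close> is the lifted point at
  \<open>Suc n\<close>, so the hypothesis orders the next lifted points strictly. This strictness
  rules out the wrong order of winding numbers.\<close>

lemma lex_code_step:
  assumes "lex_code n < lex_code m + of_int j"
  shows "lex_code (Suc n) < lex_code (Suc m) + of_int j"
proof -
  let ?n = "Suc n" and ?m = "Suc m"
  have less: "xs ?n + of_int (winding ?n) < xs ?m + of_int (winding ?m + j)"
    using assms winding_Suc[of n] winding_Suc[of m] by (simp add: lex_code_def)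
  have "a * xs ?n < 1"
    using mult_left_le[of "xs ?n" a] xs_bounds[of ?n] a_pos a_less_1 by linarith
  have "0 \<le> a * xs ?m"
    using xs_bounds[of ?m] a_pos by simp
  consider "winding ?n = winding ?m + j" | "winding ?n + 1 \<le> winding ?m + j" | "winding ?m + j + 1 \<le> winding ?n"
    by linarith
  then show ?thesis
  proof cases
    case 1
    then have "a * xs ?n < a * xs ?m"
      using less a_pos by simp
    then show ?thesis
      using 1 by (simp add: lex_code_def)
  next
    case 2
    then have "real_of_int (winding ?n + 1) \<le> of_int (winding ?m + j)"
      by (simp only: of_int_le_iff)
    then show ?thesis
      using \<open>a * xs ?n < 1\<close> \<open>0 \<le> a * xs ?m\<close> by (simp add: lex_code_def)
  next
    case 3
    then have "real_of_int (winding ?m + j + 1) \<le> of_int (winding ?n)"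
      by (simp only: of_int_le_iff)
    then show ?thesis
      using less xs_bounds[of ?n] xs_bounds[of ?m] by simp
  qed
qed

lemma lex_code_shift:
  assumes "lex_code n < lex_code m + of_int j"
  shows "lex_code (n + i) < lex_code (m + i) + of_int j"
  using assms by (induction i) (auto intro: lex_code_step)

lemma coprime_winding:
  assumes inj: "inj_on xs {..<q}"
  shows "coprime (winding q) (int q)"
proof (rule ccontr)
  assume "\<not> coprime (winding q) (int q)"
  define g where "g = nat (gcd (winding q) (int q))"
  have "int g = gcd (winding q) (int q)"
    by (simp add: g_def)
  then obtain p' q'' where p': "winding q = int g * p'" and q'': "int q = int g * q''"
    by (metis dvd_def gcd_dvd1 gcd_dvd2)
  have "g > 0" "g \<noteq> 1"
    using \<open>int g = _\<close> q_ge_1 \<open>\<not> coprime _ _\<close> by (auto simp: coprime_iff_gcd_eq_1 intro!: gr0I)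
  have "q'' > 0"
    using q'' q_ge_1 \<open>g > 0\<close> by (metis of_nat_0_less_iff of_nat_0_le_iff less_le_trans zero_less_one zero_less_mult_pos)
  define q' where "q' = nat q''"
  have q': "q = g * q'" "q' > 0"
    using q'' \<open>q'' > 0\<close> by (simp_all add: q'_def flip: of_nat_eq_iff[where 'a = int])
  have "q' < q"
    using q' \<open>g > 0\<close> \<open>g \<noteq> 1\<close> by simp
  have full_turn: "lex_code (g * q') = lex_code 0 + of_int (int g * p')"
    using xs_add_period[of 0] by (simp add: lex_code_def winding_0 flip: q'(1) p')
  have up: "lex_code 0 < lex_code (Suc k * q') - of_int (int (Suc k) * p')"
    if "lex_code 0 < lex_code q' + of_int (- p')" for k
  proof (induction k)
    case (Suc k)
    then show ?case
      using lex_code_shift[OF that, of "Suc k * q'"] by (simp add: algebra_simps)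
  qed (use that in simp)
  have down: "lex_code (Suc k * q') - of_int (int (Suc k) * p') < lex_code 0"
    if "lex_code q' < lex_code 0 + of_int p'" for k
  proof (induction k)
    case (Suc k)
    then show ?case
      using lex_code_shift[OF that, of "Suc k * q'"] by (simp add: algebra_simps)
  qed (use that in simp)
  \<comment> \<open>In either strict case, \<open>g\<close> shifts accumulate a strict inequality
    that contradicts \<open>full_turn\<close>.\<close>
  have "lex_code q' = lex_code 0 + of_int p'"
    using up[of "g - 1"] down[of "g - 1"] full_turn \<open>g > 0\<close> by fastforce
  then have eq: "a * (xs 0 - xs q') = of_int (winding q' - p')"
    by (simp add: lex_code_def winding_0 algebra_simps)
  have "\<bar>xs 0 - xs q'\<bar> \<le> 1"
    using xs_bounds[of 0] xs_bounds[of q'] by linarith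
  then have "\<bar>a * (xs 0 - xs q')\<bar> < 1"
    using a_pos a_less_1 mult_left_le[of "\<bar>xs 0 - xs q'\<bar>" a]
    unfolding abs_mult by linarith
  \<comment> \<open>The right side of \<open>eq\<close> is an integer of absolute value below
    1.\<close>
  then have "winding q' - p' = 0"
    unfolding eq by linarith
  then have "xs 0 = xs q'"
    using eq a_pos by simp
  then show False
    using inj_onD[OF inj, of 0 q'] \<open>q' < q\<close> \<open>q' > 0\<close> by simp
qed

end

theorem theorem8p1:
  fixes a b :: real
  assumes "0 < a" and "a < 1" and "0 \<le> b" and "b < 1"
  shows
    "(\<forall>\<rho> (p::int) (q::nat).
        \<rho> = rotation_number a b \<and> q \<ge> 1 \<and> coprime p (int q) \<and> \<rho> = of_int p / real q \<longrightarrow>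
        (\<exists>xs C. minimal_periodic_orbit a b q xs \<and> C = xs ` {..<q} \<and>
           C = {phi a b \<rho> (real k / real q) | k. k \<in> {0..q - 1}} \<and>
           Min C = phi a b \<rho> 0 \<and> phi a b \<rho> 0 = psi a b \<rho> \<and>
           Max C = phi a b \<rho> ((real q - 1) / real q) \<and>
           (phi a b \<rho> \<longlongrightarrow> Max C) (at_left 1) \<and>
           (\<exists>l. (psi a b \<longlongrightarrow> l) (at_right \<rho>) \<and> Max C = 1 + l))) \<and>
     ((\<exists>q xs. periodic_orbit a b q xs) \<longrightarrow> rotation_number a b \<in> \<rat>) \<and>
     (\<forall>q xs. minimal_periodic_orbit a b q xs \<longrightarrow>
        (\<exists>p::int. coprime p (int q) \<and> rotation_number a b = of_int p / real q))"
proof -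
  interpret affine_circle_map a b
    using assms by unfold_locales
  show ?thesis
  proof (intro conjI allI impI; (elim conjE exE)?)
    fix \<rho> and p :: int and q :: nat
    assume \<rho>: "\<rho> = rotation_number a b" "\<rho> = of_int p / real q" and q: "q \<ge> 1" and cop: "coprime p (int q)"
    define xs where "xs = (\<lambda>n. phi a b \<rho> (frac (real n * \<rho>)))"
    define C where "C = xs ` {..<q}"
    have orbit: "minimal_periodic_orbit a b q xs"
      and C: "C = (\<lambda>k. phi a b \<rho> (real k / real q)) ` {..<q}"
      using rational_rotation_orbit[OF q cop] \<rho> unfolding xs_def C_def by simp_all
    have "{0..q - 1} = {..<q}"
      using q by auto
    then have C_set: "C = {phi a b \<rho> (real k / real q) | k. k \<in> {0..q - 1}}"
      unfolding C by blast
    have "finite C"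
      by (simp add: C_def)
    then have Min: "Min C = phi a b \<rho> 0"
      using q by (intro Min_eqI) (auto simp: C intro: phi_mono image_eqI[of _ _ 0])
    have "phi a b \<rho> ((real q - 1) / real q) \<in> C"
      unfolding C using q by (intro image_eqI[of _ _ "q - 1"]) auto
    moreover have "y \<le> phi a b \<rho> ((real q - 1) / real q)" if "y \<in> C" for y
      using that unfolding C by (auto intro!: phi_mono divide_right_mono)
    ultimately have Max: "Max C = phi a b \<rho> ((real q - 1) / real q)"
      using \<open>finite C\<close> by (intro Max_eqI)
    show "\<exists>xs C. minimal_periodic_orbit a b q xs \<and> C = xs ` {..<q} \<and>
           C = {phi a b \<rho> (real k / real q) | k. k \<in> {0..q - 1}} \<and>
           Min C = phi a b \<rho> 0 \<and> phi a b \<rho> 0 = psi a b \<rho> \<and>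
           Max C = phi a b \<rho> ((real q - 1) / real q) \<and>
           (phi a b \<rho> \<longlongrightarrow> Max C) (at_left 1) \<and>
           (\<exists>l. (psi a b \<longlongrightarrow> l) (at_right \<rho>) \<and> Max C = 1 + l)"
    proof (intro exI conjI)
      show "(phi a b \<rho> \<longlongrightarrow> Max C) (at_left 1)"
        unfolding Max unfolding \<rho>(2) using q by (rule phi_tendsto_left_1)
      show "Max C = 1 + psi_right \<rho>"
        unfolding Max unfolding \<rho>(2) using q by (rule phi_last_eq_psi_right)
    qed (fact orbit C_def C_set Min Max psi_tendsto_right psi_def[symmetric])+
  next
    fix q xs
    assume "periodic_orbit a b q xs"
    then interpret periodic_orbit_lift a b q xs
      by unfold_locales
    show "rotation_number a b \<in> \<rat>"
      by (simp add: rotation_number_eq_winding)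
  next
    fix q xs
    assume minimal: "minimal_periodic_orbit a b q xs"
    then interpret periodic_orbit_lift a b q xs
      by unfold_locales (simp add: minimal_periodic_orbit_def)
    show "\<exists>p::int. coprime p (int q) \<and> rotation_number a b = of_int p / real q"
      using minimal coprime_winding rotation_number_eq_winding
      by (auto simp: minimal_periodic_orbit_def)
  qed
qed

end
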